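(* For a commutative semigroup $X$ the following conditions are equivalent: (1) the semigroup $\upsilon^\bullet(X)$ is commutative; (2) $\upsilon^\bullet(X)$ is supercommutative; (3) $\mathcal A*\mathcal B^\perp=\mathcal B^\perp*\mathcal A$ for any filters $\mathcal A,\mathcal B\in\varphi^\bullet(X)$; (4) $\mathcal A*\mathcal B=\mathcal A\circledast\mathcal B$ for any upfamilies $\mathcal A\in\upsilon^\bullet(X)$ and $\mathcal B\in\upsilon(X)$; (5) $\{xu,yv\}\cap\{xv,yu\}\ne\emptyset$ for any points $x,y,u,v\in X$; (6) $X$ is a square-linear semigroup whose digraph $(X,\Delta)$ contains no bipartite cycles.
   Context: An upfamily on a nonempty set $X$ is a nonempty family $\mathcal F$ of nonempty subsets of $X$ such that $F\in\mathcal F$ and $F\subset E\subset X$ imply $E\in\mathcal F$; $\upsilon(X)$ is the set of all upfamilies on $X$. A family $\mathcal G$ of nonempty subsets of $X$ generates the upfamily $\langle G:G\in\mathcal G\rangle=\{E\subset X:\exists G\in\mathcal G,\ G\subset E\}$. The transversal of $\mathcal F\in\upsilon(X)$ is $\mathcal F^\perp=\{E\subset X:\forall F\in\mathcal F,\ E\cap F\ne\emptyset\}\in\upsilon(X)$. An upfamily is finitely supported if it equals $\langle F_1,\dots,F_n\rangle$ for some (finitely many, at least one) nonempty finite sets $F_i\subset X$; $\upsilon^\bullet(X)$ is the set of finitely supported upfamilies. A filter is an upfamily closed under pairwise intersections; $\varphi^\bullet(X)$ is the set of finitely supported filters. If $X$ is a semigroup, put for $\mathcal A,\mathcal B\in\upsilon(X)$: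 $\mathcal A*\mathcal B=\langle\bigcup_{a\in A}aB_a: A\in\mathcal A,\ (B_a)_{a\in A}\in\mathcal B^A\rangle$ and $\mathcal A\circledast\mathcal B=\langle AB:A\in\mathcal A,\ B\in\mathcal B\rangle$, where $AB=\{ab:a\in A,b\in B\}$. The operation $*$ is associative and $\upsilon^\bullet(X)$ is a subsemigroup of $(\upsilon(X),* )$. A subsemigroup $S$ of $(\upsilon(X),* )$ is commutative if $\mathcal A*\mathcal B=\mathcal B*\mathcal A$ for all $\mathcal A,\mathcal B\in S$, and supercommutative if $\mathcal A*\mathcal B=\mathcal A\circledast\mathcal B=\mathcal B\circledast\mathcal A=\mathcal B*\mathcal A$ for all $\mathcal A,\mathcal B\in S$. A semigroup $X$ is square-linear if $xy\in\{x^2,y^2\}$ for all $x,y\in X$; it is endowed with the digraph structure $\Delta=\{(x,y)\in X\times X:xy=x^2\}$. A cycle of length $n\ge 1$ in $(X,\Delta)$ is a sequence $x_0,\dots,x_n$ of vertices with $x_0=x_n$ and $(x_i,x_{i+1})\in\Delta$ for all $i<n$. It is bipartite if $n$ is even and $(x_i,x_j)\notin\Delta\cap\Delta^{-1}$ for all $i,j\in\{1,\dots,n\}$ with $i-j$ odd, where $\Delta^{-1}=\{(y,x):(x,y)\in\Delta\}$. *)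

theory Defs
  imports "HOL-Library.Set_Algebras" "HOL-Library.FuncSet"
begin

section \<open>Upfamilies\<close>

definition upfamily :: "'a set set \<Rightarrow> bool"
  where "upfamily \<F> \<longleftrightarrow>
    \<F> \<noteq> {} \<and> {} \<notin> \<F> \<and> (\<forall>F\<in>\<F>. \<forall>E. F \<subseteq> E \<longrightarrow> E \<in> \<F>)"

definition upfamilies :: "'a set set set"
  where "upfamilies = {\<F>. upfamily \<F>}"

definition up_gen :: "'a set set \<Rightarrow> 'a set set"
  where "up_gen \<G> = {E. \<exists>G\<in>\<G>. G \<subseteq> E}"

definition transversal :: "'a set set \<Rightarrow> 'a set set"
  where "transversal \<F> = {E. \<forall>F\<in>\<F>. E \<inter> F \<noteq> {}}"

definition finitely_supported :: "'a set set \<Rightarrow> bool"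
  where "finitely_supported \<F> \<longleftrightarrow>
    (\<exists>\<G>. finite \<G> \<and> \<G> \<noteq> {} \<and> (\<forall>G\<in>\<G>. finite G \<and> G \<noteq> {}) \<and> \<F> = up_gen \<G>)"

definition fs_upfamilies :: "'a set set set"
  where "fs_upfamilies = {\<F>. upfamily \<F> \<and> finitely_supported \<F>}"

definition filter_upfamily :: "'a set set \<Rightarrow> bool"
  where "filter_upfamily \<F> \<longleftrightarrow> upfamily \<F> \<and> (\<forall>A\<in>\<F>. \<forall>B\<in>\<F>. A \<inter> B \<in> \<F>)"

definition fs_filters :: "'a set set set"
  where "fs_filters = {\<F>. filter_upfamily \<F> \<and> finitely_supported \<F>}"


section \<open>Operations on upfamilies over a semigroup\<close>

text \<open>
  On subsets of the semigroup, \<open>a *o B\<close> is the translate \<open>aB\<close> and \<open>A * B\<close> is the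
  elementwise product \<open>AB\<close> (both from Set_Algebras).
\<close>

definition up_mult :: "'a::semigroup_mult set set \<Rightarrow> 'a set set \<Rightarrow> 'a set set"
    (infixl \<open>\<star>\<close> 70)
  where "\<A> \<star> \<B> = up_gen {\<Union>a\<in>A. a *o B a | A B. A \<in> \<A> \<and> B \<in> A \<rightarrow> \<B>}"

definition up_smult :: "'a::semigroup_mult set set \<Rightarrow> 'a set set \<Rightarrow> 'a set set"
    (infixl \<open>\<odot>\<close> 70)
  where "\<A> \<odot> \<B> = up_gen {A * B | A B. A \<in> \<A> \<and> B \<in> \<B>}"

definition up_commutative :: "'a::semigroup_mult set set set \<Rightarrow> bool"
  where "up_commutative S \<longleftrightarrow> (\<forall>\<A>\<in>S. \<forall>\<B>\<in>S. \<A> \<star> \<B> = \<B> \<star> \<A>)"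

definition up_supercommutative :: "'a::semigroup_mult set set set \<Rightarrow> bool"
  where "up_supercommutative S \<longleftrightarrow>
    (\<forall>\<A>\<in>S. \<forall>\<B>\<in>S. \<A> \<star> \<B> = \<A> \<odot> \<B> \<and> \<A> \<odot> \<B> = \<B> \<odot> \<A> \<and> \<B> \<odot> \<A> = \<B> \<star> \<A>)"


section \<open>Square-linear semigroups and bipartite cycles\<close>

definition square_linear :: "'a::semigroup_mult itself \<Rightarrow> bool"
  where "square_linear _ \<longleftrightarrow> (\<forall>x y :: 'a. x * y \<in> {x * x, y * y})"

definition square_digraph :: "('a::semigroup_mult) rel"
  where "square_digraph = {(x, y). x * y = x * x}"

text \<open>
  A cycle of length \<open>n\<close> is a closed walk \<open>x 0, \<dots>, x n\<close>; vertices may repeat, and the values of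
  \<open>x\<close> beyond \<open>n\<close> are irrelevant.
\<close>

definition digraph_cycle :: "'a rel \<Rightarrow> nat \<Rightarrow> (nat \<Rightarrow> 'a) \<Rightarrow> bool"
  where "digraph_cycle D n x \<longleftrightarrow> 1 \<le> n \<and> x 0 = x n \<and> (\<forall>i<n. (x i, x (Suc i)) \<in> D)"

definition bipartite_cycle :: "'a rel \<Rightarrow> nat \<Rightarrow> (nat \<Rightarrow> 'a) \<Rightarrow> bool"
  where "bipartite_cycle D n x \<longleftrightarrow> digraph_cycle D n x \<and> even n \<and>
    (\<forall>i\<in>{1..n}. \<forall>j\<in>{1..n}. odd (int i - int j) \<longrightarrow> (x i, x j) \<notin> D \<inter> D\<inverse>)"

end

theory Submission
  imports Defs
begin

text \<open>
  Condition (5) says that for every set \<open>W\<close> the sets \<open>N u = {x. x * u \<in> W}\<close> form a chain under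
  inclusion. Given \<open>W = (\<Union>a\<in>A. a *o B a)\<close> with \<open>A\<close> finite, each intersection
  \<open>(\<Inter>u\<in>B a. N u)\<close> contains \<open>a\<close>; the largest of these finitely many comparable sets
  contains all of \<open>A\<close>, so \<open>A * B a \<subseteq> W\<close> for a single \<open>a\<close>, which gives (4).
  Conversely, (3) applied to the filters generated by \<open>{x, y}\<close> and \<open>{u, v}\<close> gives (5).
  For (6), a quadruple violating (5) is a bipartite cycle of length four, and along a bipartite cycle
  (5) propagates the arrows \<open>x 0 \<rightarrow> x (2k + 1)\<close> until one of them reverses the last edge.
\<close>

section \<open>Upfamilies\<close>

lemma upfamily_up_gen:
  assumes "\<G> \<noteq> {}" "{} \<notin> \<G>"
  shows "upfamily (up_gen \<G>)"
  using assms unfolding upfamily_def up_gen_def by auto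

lemma fs_upfamilies_subset_upfamilies: "fs_upfamilies \<subseteq> upfamilies"
  by (auto simp: fs_upfamilies_def upfamilies_def)

lemma up_gen_in_fs_upfamilies:
  assumes "finite \<G>" "\<G> \<noteq> {}" "\<And>G. G \<in> \<G> \<Longrightarrow> finite G \<and> G \<noteq> {}"
  shows "up_gen \<G> \<in> fs_upfamilies"
proof -
  have "upfamily (up_gen \<G>)"
    using assms by (intro upfamily_up_gen) auto
  then show ?thesis
    using assms unfolding fs_upfamilies_def finitely_supported_def by blast
qed

lemma up_gen_singleton_in_fs_filters:
  assumes "finite G" "G \<noteq> {}"
  shows "up_gen {G} \<in> fs_filters"
proof -
  have "up_gen {G} \<in> fs_upfamilies"
    using assms by (intro up_gen_in_fs_upfamilies) auto
  then show ?thesis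
    by (auto simp: fs_filters_def fs_upfamilies_def filter_upfamily_def up_gen_def)
qed

lemma fs_filters_subset_fs_upfamilies: "fs_filters \<subseteq> fs_upfamilies"
  by (auto simp: fs_filters_def fs_upfamilies_def filter_upfamily_def)

lemma fs_upfamilies_finite_subset:
  assumes "\<A> \<in> fs_upfamilies" "A \<in> \<A>"
  obtains G where "G \<in> \<A>" "G \<subseteq> A" "finite G" "G \<noteq> {}"
  using assms unfolding fs_upfamilies_def finitely_supported_def up_gen_def by auto

text \<open>Whether a set meets every member of \<open>\<F>\<close> depends only on its trace on the
  finite set \<open>\<Union>\<G>\<close>, so the hitting sets inside \<open>\<Union>\<G>\<close>
  generate the transversal. This makes the condition on filters a special case of
  commutativity.\<close>

lemma transversal_in_fs_upfamilies:
  assumes "\<F> \<in> fs_upfamilies"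
  shows "transversal \<F> \<in> fs_upfamilies"
proof -
  from assms obtain \<G> where fin: "finite \<G>" and ne: "\<G> \<noteq> {}"
    and G: "\<And>G. G \<in> \<G> \<Longrightarrow> finite G \<and> G \<noteq> {}" and F: "\<F> = up_gen \<G>"
    unfolding fs_upfamilies_def finitely_supported_def by blast
  define \<H> where "\<H> = {H. H \<subseteq> \<Union>\<G> \<and> (\<forall>G\<in>\<G>. H \<inter> G \<noteq> {})}"
  have U: "finite (\<Union>\<G>)"
    using fin G by blast
  have "transversal \<F> = up_gen \<H>"
  proof (intro equalityI subsetI)
    fix E assume "E \<in> transversal \<F>"
    then have "\<forall>G\<in>\<G>. E \<inter> G \<noteq> {}"
      unfolding transversal_def F up_gen_def by blast
    then have "E \<inter> \<Union>\<G> \<in> \<H>"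
      unfolding \<H>_def by blast
    then show "E \<in> up_gen \<H>"
      unfolding up_gen_def by blast
  next
    fix E assume "E \<in> up_gen \<H>"
    then show "E \<in> transversal \<F>"
      unfolding transversal_def F up_gen_def \<H>_def by blast
  qed
  moreover have "up_gen \<H> \<in> fs_upfamilies"
  proof (rule up_gen_in_fs_upfamilies)
    show "finite \<H>"
      using U unfolding \<H>_def by (rule rev_finite_subset[OF finite_Pow_iff[THEN iffD2]]) auto
    have "\<Union>\<G> \<in> \<H>"
      using G unfolding \<H>_def by blast
    then show "\<H> \<noteq> {}" by blast
    show "finite H \<and> H \<noteq> {}" if "H \<in> \<H>" for H
      using that U ne unfolding \<H>_def by (auto intro: finite_subset)
  qed
  ultimately show ?thesis by simp
qed

section \<open>Products of upfamilies\<close>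

lemma up_mult_iff:
  "E \<in> \<A> \<star> \<B> \<longleftrightarrow> (\<exists>A\<in>\<A>. \<exists>B\<in>A \<rightarrow> \<B>. (\<Union>a\<in>A. a *o B a) \<subseteq> E)"
  unfolding up_mult_def up_gen_def by blast

lemma up_smult_iff: "E \<in> \<A> \<odot> \<B> \<longleftrightarrow> (\<exists>A\<in>\<A>. \<exists>B\<in>\<B>. A * B \<subseteq> E)"
  unfolding up_smult_def up_gen_def by blast

text \<open>The elementwise product is the case of a constant family \<open>B\<close>.\<close>

lemma up_smult_subset_up_mult: "\<A> \<odot> \<B> \<subseteq> \<A> \<star> \<B>"
proof
  fix E assume "E \<in> \<A> \<odot> \<B>"
  then obtain A B where AB: "A \<in> \<A>" "B \<in> \<B>" "A * B \<subseteq> E"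
    unfolding up_smult_iff by blast
  have "(\<Union>a\<in>A. a *o B) \<subseteq> E"
    using AB(3) by (auto simp: elt_set_times_def set_times_def)
  moreover have "(\<lambda>_. B) \<in> A \<rightarrow> \<B>"
    using AB(2) by simp
  ultimately show "E \<in> \<A> \<star> \<B>"
    using AB(1) unfolding up_mult_iff by (intro bexI[of _ A] bexI[of _ "\<lambda>_. B"])
qed

lemma up_smult_commute:
  fixes \<A> \<B> :: "'a::ab_semigroup_mult set set"
  shows "\<A> \<odot> \<B> = \<B> \<odot> \<A>"
proof -
  have "\<A> \<odot> \<B> \<subseteq> \<B> \<odot> \<A>" for \<A> \<B> :: "'a set set"
  proof
    fix E assume "E \<in> \<A> \<odot> \<B>"
    then obtain A B where "A \<in> \<A>" "B \<in> \<B>" "B * A \<subseteq> E"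
      unfolding up_smult_iff by (auto simp: mult.commute)
    then show "E \<in> \<B> \<odot> \<A>"
      unfolding up_smult_iff by blast
  qed
  then show ?thesis by blast
qed

lemma up_mult_eq_up_smult:
  fixes \<A> \<B> :: "'a::semigroup_mult set set"
  assumes exch: "\<And>x y u v :: 'a. {x * u, y * v} \<inter> {x * v, y * u} \<noteq> {}"
    and \<A>: "\<A> \<in> fs_upfamilies"
  shows "\<A> \<star> \<B> = \<A> \<odot> \<B>"
proof (intro equalityI up_smult_subset_up_mult subsetI)
  fix E assume "E \<in> \<A> \<star> \<B>"
  then obtain A B where A: "A \<in> \<A>" and B: "B \<in> A \<rightarrow> \<B>" and E: "(\<Union>a\<in>A. a *o B a) \<subseteq> E"
    unfolding up_mult_iff by blast
  obtain G where G: "G \<in> \<A>" "G \<subseteq> A" "finite G" "G \<noteq> {}"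
    using fs_upfamilies_finite_subset[OF \<A> A] by blast
  \<comment> \<open>\<open>M a\<close> is the part of the finite set \<open>G\<close> that all of
    \<open>B a\<close> multiplies into \<open>E\<close>; finiteness provides a maximal such
    part.\<close>
  define M where "M a = {x \<in> G. \<forall>u\<in>B a. x * u \<in> E}" for a
  have mem: "a \<in> M a" if "a \<in> G" for a
    using that E G(2) unfolding M_def elt_set_times_def by blast
  have chain: "M a \<subseteq> M b \<or> M b \<subseteq> M a" for a b
  proof (rule ccontr)
    assume "\<not> ?thesis"
    \<comment> \<open>Here \<open>x * u\<close> and \<open>y * v\<close> lie in \<open>E\<close>,
      while \<open>x * v\<close> and \<open>y * u\<close> do not, so the two pairs in
      \<open>exch\<close> would be disjoint.\<close>
    then obtain x y u v where "x * v \<notin> E" "v \<in> B b" "x \<in> M a" "y * u \<notin> E" "u \<in> B a" "y \<in> M b"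
      unfolding M_def by blast
    then show False
      using exch[of x u y v] unfolding M_def by auto
  qed
  obtain m where m: "m \<in> G" "\<And>a. a \<in> G \<Longrightarrow> \<not> M m \<subset> M a"
    using finite_has_maximal[of "M ` G"] G(3,4) by (auto simp: psubset_eq)
  \<comment> \<open>By \<open>chain\<close> and maximality, \<open>M m\<close> contains every
    \<open>M a\<close> with \<open>a \<in> G\<close>, hence every such \<open>a\<close>.\<close>
  have "G \<subseteq> M m"
    using m chain mem by blast
  then have "G * B m \<subseteq> E"
    unfolding M_def set_times_def by blast
  moreover have "B m \<in> \<B>"
    using B G(2) m(1) by blast
  ultimately show "E \<in> \<A> \<odot> \<B>"
    using G(1) unfolding up_smult_iff by blast
qed

text \<open>Choosing \<open>u\<close> at \<open>x\<close> and \<open>v\<close> at \<open>y\<close>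
  puts \<open>{x * u, y * v}\<close> into the left product. Membership in the right product yields
  some \<open>d \<in> {u, v}\<close> with \<open>d * x\<close> and \<open>d * y\<close> both in this
  set; for \<open>d = u\<close> the common element is \<open>y * u\<close>, for \<open>d = v\<close>
  it is \<open>x * v\<close>.\<close>

lemma exchange_if_filters_commute_with_transversals:
  fixes x y u v :: "'a::ab_semigroup_mult"
  assumes comm: "\<And>\<A> \<B> :: 'a set set. \<A> \<in> fs_filters \<Longrightarrow> \<B> \<in> fs_filters \<Longrightarrow>
    \<A> \<star> transversal \<B> = transversal \<B> \<star> \<A>"
  shows "{x * u, y * v} \<inter> {x * v, y * u} \<noteq> {}"
\<comment> \<open>The choice function \<open>S\<close> below can separate \<open>x\<close> from
  \<open>y\<close> only if they are distinct.\<close>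
proof (cases "x = y")
  case True
  then show ?thesis by simp
next
  case False
  let ?A = "up_gen {{x, y}}" and ?B = "transversal (up_gen {{u, v}})"
  have B: "D \<in> ?B \<longleftrightarrow> u \<in> D \<or> v \<in> D" for D
    unfolding transversal_def up_gen_def by auto
  define S where "S a = (if a = x then {u} else {v})" for a
  have "{x, y} \<in> ?A"
    by (simp add: up_gen_def)
  moreover have "S \<in> {x, y} \<rightarrow> ?B"
    by (auto simp: B S_def)
  moreover have "(\<Union>a\<in>{x, y}. a *o S a) \<subseteq> {x * u, y * v}"
    using False by (auto simp: S_def elt_set_times_def)
  ultimately have "{x * u, y * v} \<in> ?A \<star> ?B"
    unfolding up_mult_iff by blast
  also have "?A \<star> ?B = ?B \<star> ?A"
    by (intro comm up_gen_singleton_in_fs_filters) auto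
  finally obtain D C where D: "D \<in> ?B" and C: "C \<in> D \<rightarrow> ?A"
    and sub: "(\<Union>d\<in>D. d *o C d) \<subseteq> {x * u, y * v}"
    unfolding up_mult_iff by blast
  have prod: "d * x \<in> {x * u, y * v} \<and> d * y \<in> {x * u, y * v}" if "d \<in> D" for d
  proof -
    have "{x, y} \<subseteq> C d"
      using C that by (auto simp: up_gen_def)
    then show ?thesis
      using sub that unfolding elt_set_times_def by blast
  qed
  from D consider "u \<in> D" | "v \<in> D"
    using B by blast
  then show ?thesis
  proof cases
    case 1
    then show ?thesis using prod[of u] by (auto simp: mult.commute)
  next
    case 2
    then show ?thesis using prod[of v] by (auto simp: mult.commute)
  qed
qed

section \<open>Bipartite cycles\<close>

lemma no_bipartite_cycle_if_exchange:
  assumes exch: "\<And>x y u v :: 'a::ab_semigroup_mult. {x * u, y * v} \<inter> {x * v, y * u} \<noteq> {}"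
    and sl: "square_linear TYPE('a)"
  shows "\<not> bipartite_cycle (square_digraph :: 'a rel) n x"
proof
  assume cyc: "bipartite_cycle (square_digraph :: 'a rel) n x"
  then have n: "1 \<le> n" "even n" and x0: "x 0 = x n"
    and edge: "\<And>i. i < n \<Longrightarrow> x i * x (Suc i) = x i * x i"
    and bip: "\<And>i j. \<lbrakk>i \<in> {1..n}; j \<in> {1..n}; odd (int i - int j)\<rbrakk> \<Longrightarrow>
      \<not> (x i * x j = x i * x i \<and> x j * x i = x j * x j)"
    unfolding bipartite_cycle_def digraph_cycle_def square_digraph_def by auto
  have sl': "a * b = a * a \<or> a * b = b * b" for a b :: 'a
    using sl unfolding square_linear_def by auto
  \<comment> \<open>Equal squares would, by \<open>sl'\<close> and commutativity, give arrows both
    ways between vertices of opposite parity.\<close>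
  have sq: "x i * x i \<noteq> x j * x j" if "i \<in> {1..n}" "j \<in> {1..n}" "odd (int i - int j)" for i j
    using bip[OF that] sl'[of "x i" "x j"] by (metis mult.commute)
  \<comment> \<open>The start is written \<open>x n\<close> rather than \<open>x 0\<close> because
    \<open>bip\<close> covers the indices from 1 to \<open>n\<close>.\<close>
  have "x n * x (2 * k + 1) = x n * x n" if "2 * k + 1 < n" for k
    using that
  proof (induction k)
    case 0
    then show ?case using edge[of 0] n x0 by simp
  next
    case (Suc k)
    let ?u = "x (2 * k + 1)" and ?y = "x (2 * k + 2)" and ?v = "x (2 * k + 3)"
    have IH: "x n * ?u = x n * x n" and uy: "?u * ?y = ?u * ?u" and yv: "?y * ?v = ?y * ?y"
      using Suc edge[of "2 * k + 1"] edge[of "2 * k + 2"] by (auto simp: eval_nat_numeral)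
    have ne: "x n * x n \<noteq> ?u * ?u" "x n * x n \<noteq> ?v * ?v" "?y * ?y \<noteq> ?u * ?u" "?y * ?y \<noteq> ?v * ?v"
      using Suc.prems n sq[of n "2 * k + 1"] sq[of n "2 * k + 3"]
        sq[of "2 * k + 2" "2 * k + 1"] sq[of "2 * k + 2" "2 * k + 3"] by simp_all
    \<comment> \<open>Since \<open>?u * ?u\<close> differs from both elements on the left,
      \<open>x n * ?v\<close> is one of them, and neither equals \<open>?v * ?v\<close>.\<close>
    have "{x n * x n, ?y * ?y} \<inter> {x n * ?v, ?u * ?u} \<noteq> {}"
      using exch[of "x n" ?u ?y ?v] unfolding IH yv mult.commute[of ?y ?u] uy .
    then have "x n * ?v \<noteq> ?v * ?v"
      using ne by force
    then show ?case
      using sl'[of "x n" ?v] by (simp add: eval_nat_numeral)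
  qed
  \<comment> \<open>As \<open>n\<close> is even, the last odd index below it is
    \<open>n - 1\<close>; the arrow from \<open>x n\<close> to that vertex reverses the last
    edge.\<close>
  moreover obtain k where k: "n = 2 * k + 2"
  proof
    show "n = 2 * (n div 2 - 1) + 2"
      using n by presburger
  qed
  ultimately have "x n * x (2 * k + 1) = x n * x n"
    by simp
  moreover have "x (2 * k + 1) * x n = x (2 * k + 1) * x (2 * k + 1)"
    using edge[of "2 * k + 1"] k by simp
  moreover have "odd (int n - int (2 * k + 1))" "n \<in> {1..n}" "2 * k + 1 \<in> {1..n}"
    using k by auto
  ultimately show False
    using bip[of n "2 * k + 1"] by simp
qed

text \<open>The hypothesis \<open>xu\<close> orients the first edge, and disjointness forces the
  others in turn: \<open>x * v = v * v\<close>, then \<open>y * v = y * y\<close>, then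
  \<open>y * u = u * u\<close>.\<close>

lemma bipartite_four_cycle:
  fixes x y u v :: "'a::ab_semigroup_mult"
  assumes sl: "square_linear TYPE('a)"
    and disj: "{x * u, y * v} \<inter> {x * v, y * u} = {}"
    and xu: "x * u = x * x"
  shows "bipartite_cycle square_digraph 4 (\<lambda>i. [x, u, y, v, x] ! i)"
proof -
  have sl': "a * b = a * a \<or> a * b = b * b" for a b :: 'a
    using sl unfolding square_linear_def by auto
  have ne: "x * u \<noteq> x * v" "x * u \<noteq> y * u" "y * v \<noteq> x * v" "y * v \<noteq> y * u"
    using disj by auto
  have xv: "x * v = v * v" and yv: "y * v = y * y" and yu: "y * u = u * u"
    using sl'[of x v] sl'[of y v] sl'[of y u] ne xu by metis+
  have edges: "(x, u) \<in> square_digraph" "(u, y) \<in> square_digraph"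
    "(y, v) \<in> square_digraph" "(v, x) \<in> square_digraph"
    using xu xv yv yu by (simp_all add: square_digraph_def mult.commute)
  \<comment> \<open>Vertices of opposite parity are neighbours on the four-cycle, so it suffices
    that no edge has its reverse.\<close>
  have non_edges: "(u, x) \<notin> square_digraph" "(y, u) \<notin> square_digraph"
    "(v, y) \<notin> square_digraph" "(x, v) \<notin> square_digraph"
    using xu xv yv yu ne by (auto simp: square_digraph_def mult.commute)
  have four: "{1..4} = {1, 2, 3, 4::nat}" "{..<4} = {0, 1, 2, 3::nat}"
    by auto
  have "digraph_cycle square_digraph 4 (\<lambda>i. [x, u, y, v, x] ! i)"
    using edges unfolding digraph_cycle_def lessThan_iff[symmetric] Ball_def[symmetric] four
    by (simp add: eval_nat_numeral)
  then show ?thesis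
    using non_edges unfolding bipartite_cycle_def four by simp
qed

lemma exchange_if_no_bipartite_cycle:
  fixes x y u v :: "'a::ab_semigroup_mult"
  assumes sl: "square_linear TYPE('a)"
    and nocyc: "\<And>n z. \<not> bipartite_cycle (square_digraph :: 'a rel) n z"
  shows "{x * u, y * v} \<inter> {x * v, y * u} \<noteq> {}"
proof
  assume disj: "{x * u, y * v} \<inter> {x * v, y * u} = {}"
  \<comment> \<open>Interchanging \<open>x, y\<close> with \<open>u, v\<close> preserves
    disjointness; square-linearity orients the edge between \<open>x\<close> and \<open>u\<close> in
    one of the two ways.\<close>
  then have disj': "{u * x, v * y} \<inter> {u * y, v * x} = {}"
    by (auto simp: mult.commute)
  have "x * u = x * x \<or> u * x = u * u"
    using sl unfolding square_linear_def by (auto simp: mult.commute)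
  then show False
    using bipartite_four_cycle[OF sl disj] bipartite_four_cycle[OF sl disj'] nocyc by blast
qed

theorem theorem7p1:
  shows "(up_commutative (fs_upfamilies :: 'a::ab_semigroup_mult set set set)
            \<longleftrightarrow> up_supercommutative (fs_upfamilies :: 'a set set set)) \<and>
         (up_commutative (fs_upfamilies :: 'a set set set)
            \<longleftrightarrow> (\<forall>\<A>\<in>(fs_filters :: 'a set set set). \<forall>\<B>\<in>fs_filters.
                  \<A> \<star> transversal \<B> = transversal \<B> \<star> \<A>)) \<and>
         (up_commutative (fs_upfamilies :: 'a set set set)
            \<longleftrightarrow> (\<forall>\<A>\<in>(fs_upfamilies :: 'a set set set). \<forall>\<B>\<in>upfamilies.
                  \<A> \<star> \<B> = \<A> \<odot> \<B>)) \<and>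
         (up_commutative (fs_upfamilies :: 'a set set set)
            \<longleftrightarrow> (\<forall>x y u v :: 'a. {x * u, y * v} \<inter> {x * v, y * u} \<noteq> {})) \<and>
         (up_commutative (fs_upfamilies :: 'a set set set)
            \<longleftrightarrow> square_linear TYPE('a) \<and>
                \<not> (\<exists>n x. bipartite_cycle (square_digraph :: 'a rel) n x))"
proof -
  let ?S = "fs_upfamilies :: 'a set set set"
  let ?c1 = "up_commutative ?S" and ?c2 = "up_supercommutative ?S"
  let ?c3 = "\<forall>\<A>\<in>(fs_filters :: 'a set set set). \<forall>\<B>\<in>fs_filters.
    \<A> \<star> transversal \<B> = transversal \<B> \<star> \<A>"
  let ?c4 = "\<forall>\<A>\<in>?S. \<forall>\<B>\<in>upfamilies. \<A> \<star> \<B> = \<A> \<odot> \<B>"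
  let ?c5 = "\<forall>x y u v :: 'a. {x * u, y * v} \<inter> {x * v, y * u} \<noteq> {}"
  let ?c6 = "square_linear TYPE('a) \<and> \<not> (\<exists>n x. bipartite_cycle (square_digraph :: 'a rel) n x)"
  \<comment> \<open>The loop is \<open>?c1\<close>, \<open>?c3\<close>, \<open>?c5\<close>,
    \<open>?c4\<close>, \<open>?c2\<close>, \<open>?c1\<close>, with \<open>?c6\<close> attached to
    \<open>?c5\<close>.\<close>
  have "?c1 \<Longrightarrow> ?c3"
    using fs_filters_subset_fs_upfamilies transversal_in_fs_upfamilies
    unfolding up_commutative_def by blast
  moreover have "?c3 \<Longrightarrow> ?c5"
    by (intro allI exchange_if_filters_commute_with_transversals) blast
  moreover have "?c5 \<Longrightarrow> ?c4"
    by (intro ballI up_mult_eq_up_smult) simp_all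
  moreover have "?c4 \<Longrightarrow> ?c2"
    unfolding up_supercommutative_def
    by (metis fs_upfamilies_subset_upfamilies subsetD up_smult_commute)
  moreover have "?c2 \<Longrightarrow> ?c1"
    unfolding up_commutative_def up_supercommutative_def by metis
  moreover have "?c5 \<Longrightarrow> ?c6"
  proof -
    assume exch: ?c5
    have "square_linear TYPE('a)"
      unfolding square_linear_def
    proof (intro allI)
      fix x y :: 'a
      show "x * y \<in> {x * x, y * y}"
        \<comment> \<open>This instance says that \<open>{x * x, y * y}\<close> meets
          \<open>{x * y, y * x}\<close>, which is a singleton by commutativity.\<close>
        using exch[rule_format, of x x y y] by (auto simp: mult.commute)
    qed
    moreover from this have "\<not> bipartite_cycle (square_digraph :: 'a rel) n x" for n x
      using exch by (intro no_bipartite_cycle_if_exchange) simp_all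
    ultimately show ?c6 by blast
  qed
  moreover have "?c6 \<Longrightarrow> ?c5"
    by (intro allI exchange_if_no_bipartite_cycle) blast+
  ultimately show ?thesis
    by argo
qed

end
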